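(* Let $\mathbf{A}\in\mathbb{R}^{N\times N}$ be the coefficient matrix of the linear ODE system $\frac{d\mathbf{u}}{dt}=\mathbf{A}\mathbf{u}+\mathbf{b}$ obtained by the finite volume spatial discretisation, described in the context, of the $m$-layer diffusion problem with Type GI or Type GII conditions at each interface. Then all the eigenvalues of $\mathbf{A}$ are real and negative.
   Context: **Multilayer diffusion problem.** Let $m$ be a positive integer and $l_0<l_1<\dots<l_m$ real numbers. For $i=1,\dots,m$ let $D_i>0$ (diffusivity) and $\gamma_i>0$ (conductivity) be constants. The problem is $$\frac{\partial u_i}{\partial t}=D_i\frac{\partial^2u_i}{\partial x^2},\quad l_{i-1}<x<l_i,\ t>0,\qquad u_i(x,0)=f_i(x),\qquad i=1,\dots,m,$$ $$a_Lu_1(l_0,t)-b_L\frac{\partial u_1}{\partial x}(l_0,t)=c_L,\qquad a_Ru_m(l_m,t)+b_R\frac{\partial u_m}{\partial x}(l_m,t)=c_R,$$ where $a_L,b_L,c_L,a_R,b_R,c_R\ge 0$ are constants with $a_L+b_L>0$, $a_R+b_R>0$, and the case $a_L=a_R=0$ (Neumann conditions on both boundaries) is excluded. At each interface $x=l_i$ ($i=1,\dots,m-1$) one of the following pairs of conditions is imposed (the type may differ from interface to interface), with constants $\theta_i>0$, $H_i>0$: - Type GI: $u_i(l_i,t)=\theta_iu_{i+1}(l_i,t)$ and $\gamma_i\frac{\partial u_i}{\partial x}(l_i,t)=\gamma_{i+1}\frac{\partial u_{i+1}}{\partial x}(l_i,t)$. - Type GII: $\gamma_i\frac{\partial u_i}{\partial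 x}(l_i,t)=H_i(\theta_iu_{i+1}(l_i,t)-u_i(l_i,t))$ and $\gamma_i\frac{\partial u_i}{\partial x}(l_i,t)=\gamma_{i+1}\frac{\partial u_{i+1}}{\partial x}(l_i,t)$. **Mesh.** Let $n\ge 2$ be an integer, $h_i=(l_i-l_{i-1})/n$, and $x_{i,j}=l_{i-1}+jh_i$ for $i=1,\dots,m$, $j=0,\dots,n$. The discrete unknown $u_{i,j}(t)$ approximates $u_i(x_{i,j},t)$. **Unknowns.** The vector $\mathbf{u}$ lists $u_{1,0},u_{1,1},\dots,u_{1,n},u_{2,0},\dots,u_{m,n}$ in this order, but with the following entries removed and, wherever they occur in the equations below, replaced as indicated: - if $b_L=0$, $u_{1,0}$ is removed and replaced by $c_L/a_L$; - if $b_R=0$, $u_{m,n}$ is removed and replaced by $c_R/a_R$; - at each Type GI interface $x=l_i$ with $\theta_i\ge1$, $u_{i+1,0}$ is removed and replaced by $u_{i,n}/\theta_i$; - at each Type GI interface $x=l_i$ with $\theta_i<1$, $u_{i,n}$ is removed and replaced by $\theta_iu_{i+1,0}$. $N$ is the number of remaining unknowns. **Finite volume equations** (one for each remaining unknown). - Interior nodes, $1\le i\le m$, $1\le j\le n-1$: $\frac{du_{i,j}}{dt}=\frac{D_i}{h_i^2}(u_{i,j+1}-2u_{i,j}+u_{i,j-1})$. - Left boundary, if $b_L\ne0$: $\frac{du_{1,0}}{dt}=-\frac{2D_1}{h_1}\left[\frac1{h_1}+\frac{a_L}{b_L}\right]u_{1,0}+\frac{2D_1}{h_1^2}u_{1,1}+\frac{2D_1c_L}{h_1b_L}$.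 - Right boundary, if $b_R\ne0$: $\frac{du_{m,n}}{dt}=\frac{2D_m}{h_m^2}u_{m,n-1}-\frac{2D_m}{h_m}\left[\frac1{h_m}+\frac{a_R}{b_R}\right]u_{m,n}+\frac{2D_mc_R}{h_mb_R}$. - Type GI interface with $\theta_i\ge1$: $\frac{du_{i,n}}{dt}=\frac{2D_iD_{i+1}\theta_i}{\gamma_ih_i\theta_iD_{i+1}+\gamma_{i+1}h_{i+1}D_i}\left[\frac{\gamma_i}{h_i}u_{i,n-1}-\left(\frac{\gamma_i}{h_i}+\frac{\gamma_{i+1}}{\theta_ih_{i+1}}\right)u_{i,n}+\frac{\gamma_{i+1}}{h_{i+1}}u_{i+1,1}\right]$. - Type GI interface with $\theta_i<1$: $\frac{du_{i+1,0}}{dt}=\frac{2D_iD_{i+1}}{\gamma_ih_i\theta_iD_{i+1}+\gamma_{i+1}h_{i+1}D_i}\left[\frac{\gamma_i}{h_i}u_{i,n-1}-\left(\frac{\theta_i\gamma_i}{h_i}+\frac{\gamma_{i+1}}{h_{i+1}}\right)u_{i+1,0}+\frac{\gamma_{i+1}}{h_{i+1}}u_{i+1,1}\right]$. - Type GII interface: $\frac{du_{i,n}}{dt}=\frac{2D_i}{\gamma_ih_i}\left[\frac{\gamma_i}{h_i}u_{i,n-1}-\left(H_i+\frac{\gamma_i}{h_i}\right)u_{i,n}+\theta_iH_iu_{i+1,0}\right]$ and $\frac{du_{i+1,0}}{dt}=\frac{2D_{i+1}}{\gamma_{i+1}h_{i+1}}\left[H_iu_{i,n}-\left(\theta_iH_i+\frac{\gamma_{i+1}}{h_{i+1}}\right)u_{i+1,0}+\frac{\gamma_{i+1}}{h_{i+1}}u_{i+1,1}\right]$.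 Collecting these equations gives $\frac{d\mathbf{u}}{dt}=\mathbf{A}\mathbf{u}+\mathbf{b}$, with $\mathbf{A}\in\mathbb{R}^{N\times N}$ the (tridiagonal) matrix of coefficients of the unknowns and $\mathbf{b}\in\mathbb{R}^N$ the vector of constant terms. *)

theory Defs
  imports Complex_Main "Jordan_Normal_Form.Char_Poly"
begin

datatype interface_type = GI | GII

text \<open>
  Data of the multilayer diffusion problem with \<open>m\<close> layers, the \<open>i\<close>-th one occupying
  \<open>l (i - 1) < x < l i\<close> for \<open>1 \<le> i \<le> m\<close>, together with the number \<open>n\<close> of
  mesh intervals per layer. The boundary conditions are
  \<open>aL * u\<^sub>1 - bL * \<partial>u\<^sub>1/\<partial>x = cL\<close> at \<open>l 0\<close> and
  \<open>aR * u\<^sub>m + bR * \<partial>u\<^sub>m/\<partial>x = cR\<close> at \<open>l m\<close>.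
  \<open>ty i\<close> is the type of the condition imposed at the interface \<open>l i\<close>, \<open>1 \<le> i < m\<close>:
  in both cases \<open>\<gamma> i * \<partial>u\<^sub>i/\<partial>x = \<gamma> (i+1) * \<partial>u\<^sub>i\<^sub>+\<^sub>1/\<partial>x\<close>, together with
  \<open>u\<^sub>i = \<theta> i * u\<^sub>i\<^sub>+\<^sub>1\<close> for type \<open>GI\<close> and with
  \<open>\<gamma> i * \<partial>u\<^sub>i/\<partial>x = H i * (\<theta> i * u\<^sub>i\<^sub>+\<^sub>1 - u\<^sub>i)\<close> for type \<open>GII\<close>.
  Values of \<open>D\<close>, \<open>\<gamma>\<close>, \<open>\<theta>\<close>, \<open>H\<close>, \<open>ty\<close> outside these index ranges are irrelevant,
  as is \<open>H i\<close> when \<open>ty i = GI\<close>.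
\<close>

locale multilayer_fv =
  fixes m n :: nat
    and l D \<gamma> \<theta> H :: "nat \<Rightarrow> real"
    and ty :: "nat \<Rightarrow> interface_type"
    and aL bL cL aR bR cR :: real
  assumes m_pos: "m \<ge> 1"
    and n_ge_2: "n \<ge> 2"
    and l_less: "\<And>i. 1 \<le> i \<Longrightarrow> i \<le> m \<Longrightarrow> l (i - 1) < l i"
    and D_pos: "\<And>i. 1 \<le> i \<Longrightarrow> i \<le> m \<Longrightarrow> D i > 0"
    and \<gamma>_pos: "\<And>i. 1 \<le> i \<Longrightarrow> i \<le> m \<Longrightarrow> \<gamma> i > 0"
    and \<theta>_pos: "\<And>i. 1 \<le> i \<Longrightarrow> i < m \<Longrightarrow> \<theta> i > 0"
    and H_pos: "\<And>i. 1 \<le> i \<Longrightarrow> i < m \<Longrightarrow> ty i = GII \<Longrightarrow> H i > 0"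
    and boundary_nonneg: "aL \<ge> 0" "bL \<ge> 0" "cL \<ge> 0" "aR \<ge> 0" "bR \<ge> 0" "cR \<ge> 0"
    and left_nontrivial: "aL + bL > 0"
    and right_nontrivial: "aR + bR > 0"
    and not_both_Neumann: "\<not> (aL = 0 \<and> aR = 0)"
begin

definition h :: "nat \<Rightarrow> real" where
  "h i = (l i - l (i - 1)) / real n"

text \<open>The pair \<open>(i, j)\<close> stands for the mesh node \<open>l (i - 1) + j * h i\<close> of layer \<open>i\<close>.\<close>

definition nodes :: "(nat \<times> nat) list" where
  "nodes = List.product [1..<Suc m] [0..<Suc n]"

text \<open>
  In the following, \<open>w\<close> assigns values to the remaining unknowns (its values at the removed
  nodes are ignored), and \<open>grid_values w\<close> is the resulting assignment of values to all nodes.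
\<close>

definition removed :: "nat \<times> nat \<Rightarrow> bool" where
  "removed = (\<lambda>(i, j).
     i = 1 \<and> j = 0 \<and> bL = 0 \<or>
     i = m \<and> j = n \<and> bR = 0 \<or>
     1 < i \<and> j = 0 \<and> ty (i - 1) = GI \<and> \<theta> (i - 1) \<ge> 1 \<or>
     i < m \<and> j = n \<and> ty i = GI \<and> \<theta> i < 1)"

definition grid_values :: "(nat \<times> nat \<Rightarrow> real) \<Rightarrow> nat \<times> nat \<Rightarrow> real" where
  "grid_values w = (\<lambda>(i, j).
     if i = 1 \<and> j = 0 \<and> bL = 0 then cL / aL
     else if i = m \<and> j = n \<and> bR = 0 then cR / aR
     else if 1 < i \<and> j = 0 \<and> ty (i - 1) = GI \<and> \<theta> (i - 1) \<ge> 1 then w (i - 1, n) / \<theta> (i - 1)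
     else if i < m \<and> j = n \<and> ty i = GI \<and> \<theta> i < 1 then \<theta> i * w (i + 1, 0)
     else w (i, j))"

definition unknowns :: "(nat \<times> nat) list" where
  "unknowns = filter (\<lambda>p. \<not> removed p) nodes"

definition N :: nat where
  "N = length unknowns"

definition interior_rhs :: "(nat \<times> nat \<Rightarrow> real) \<Rightarrow> nat \<Rightarrow> nat \<Rightarrow> real" where
  "interior_rhs u i j = D i / (h i)\<^sup>2 * (u (i, j + 1) - 2 * u (i, j) + u (i, j - 1))"

definition left_rhs :: "(nat \<times> nat \<Rightarrow> real) \<Rightarrow> real" where
  "left_rhs u =
     - (2 * D 1 / h 1) * (1 / h 1 + aL / bL) * u (1, 0)
     + 2 * D 1 / (h 1)\<^sup>2 * u (1, 1)
     + 2 * D 1 * cL / (h 1 * bL)"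

definition right_rhs :: "(nat \<times> nat \<Rightarrow> real) \<Rightarrow> real" where
  "right_rhs u =
     2 * D m / (h m)\<^sup>2 * u (m, n - 1)
     - (2 * D m / h m) * (1 / h m + aR / bR) * u (m, n)
     + 2 * D m * cR / (h m * bR)"

definition GI_rhs_ge1 :: "(nat \<times> nat \<Rightarrow> real) \<Rightarrow> nat \<Rightarrow> real" where
  "GI_rhs_ge1 u i =
     2 * D i * D (i+1) * \<theta> i / (\<gamma> i * h i * \<theta> i * D (i+1) + \<gamma> (i+1) * h (i+1) * D i) *
     (\<gamma> i / h i * u (i, n - 1)
      - (\<gamma> i / h i + \<gamma> (i+1) / (\<theta> i * h (i+1))) * u (i, n)
      + \<gamma> (i+1) / h (i+1) * u (i+1, 1))"

definition GI_rhs_less1 :: "(nat \<times> nat \<Rightarrow> real) \<Rightarrow> nat \<Rightarrow> real" where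
  "GI_rhs_less1 u i =
     2 * D i * D (i+1) / (\<gamma> i * h i * \<theta> i * D (i+1) + \<gamma> (i+1) * h (i+1) * D i) *
     (\<gamma> i / h i * u (i, n - 1)
      - (\<theta> i * \<gamma> i / h i + \<gamma> (i+1) / h (i+1)) * u (i+1, 0)
      + \<gamma> (i+1) / h (i+1) * u (i+1, 1))"

definition GII_rhs_left :: "(nat \<times> nat \<Rightarrow> real) \<Rightarrow> nat \<Rightarrow> real" where
  "GII_rhs_left u i =
     2 * D i / (\<gamma> i * h i) *
     (\<gamma> i / h i * u (i, n - 1) - (H i + \<gamma> i / h i) * u (i, n) + \<theta> i * H i * u (i+1, 0))"

definition GII_rhs_right :: "(nat \<times> nat \<Rightarrow> real) \<Rightarrow> nat \<Rightarrow> real" where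
  "GII_rhs_right u i =
     2 * D (i+1) / (\<gamma> (i+1) * h (i+1)) *
     (H i * u (i, n) - (\<theta> i * H i + \<gamma> (i+1) / h (i+1)) * u (i+1, 0)
      + \<gamma> (i+1) / h (i+1) * u (i+1, 1))"

text \<open>
  Right-hand side of the equation for the unknown at node \<open>(i, j)\<close>, given values \<open>u\<close> at all
  nodes. It is only used at remaining unknowns: at a type \<open>GI\<close> interface, \<open>(i, n)\<close> with
  \<open>i < m\<close> remains only if \<open>\<theta> i \<ge> 1\<close>, and \<open>(i, 0)\<close> with \<open>i > 1\<close> only if \<open>\<theta> (i - 1) < 1\<close>.
\<close>

definition node_rhs :: "(nat \<times> nat \<Rightarrow> real) \<Rightarrow> nat \<times> nat \<Rightarrow> real" where
  "node_rhs u = (\<lambda>(i, j).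
     if 0 < j \<and> j < n then interior_rhs u i j
     else if j = 0 then
       (if i = 1 then left_rhs u
        else case ty (i - 1) of GI \<Rightarrow> GI_rhs_less1 u (i - 1) | GII \<Rightarrow> GII_rhs_right u (i - 1))
     else
       (if i = m then right_rhs u
        else case ty i of GI \<Rightarrow> GI_rhs_ge1 u i | GII \<Rightarrow> GII_rhs_left u i))"

definition fv_rhs :: "(nat \<times> nat \<Rightarrow> real) \<Rightarrow> nat \<times> nat \<Rightarrow> real" where
  "fv_rhs w = node_rhs (grid_values w)"

text \<open>
  The right-hand sides \<open>fv_rhs w p\<close> are affine functions of the remaining unknowns. The constant
  term is the value at \<open>w = 0\<close>, and the coefficient of the unknown \<open>q\<close> is the increment obtained
  by setting \<open>q\<close> to 1 and all other unknowns to 0. That this matrix and vector represent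
  the system is lemma \<open>fv_system\<close> below.
\<close>

definition fv_matrix :: "real mat" where
  "fv_matrix = mat N N (\<lambda>(p, q).
     fv_rhs (\<lambda>r. if r = unknowns ! q then 1 else 0) (unknowns ! p)
     - fv_rhs (\<lambda>r. 0) (unknowns ! p))"

definition fv_const :: "real vec" where
  "fv_const = vec N (\<lambda>p. fv_rhs (\<lambda>r. 0) (unknowns ! p))"

lemma node_rhs_affine:
  "node_rhs (\<lambda>x. u x + c * (v x - v' x)) p = node_rhs u p + c * (node_rhs v p - node_rhs v' p)"
proof -
  let ?u = "\<lambda>x. u x + c * (v x - v' x)"
  have 1: "interior_rhs ?u i j = interior_rhs u i j + c * (interior_rhs v i j - interior_rhs v' i j)" for i j
    unfolding interior_rhs_def by (simp add: algebra_simps)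
  have ring2: "a * (x1 + c * (y1 - z1)) + b * (x2 + c * (y2 - z2)) + d
      = a * x1 + b * x2 + d + c * ((a * y1 + b * y2 + d) - (a * z1 + b * z2 + d))"
    "a * (x1 + c * (y1 - z1)) - b * (x2 + c * (y2 - z2)) + d
      = a * x1 - b * x2 + d + c * ((a * y1 - b * y2 + d) - (a * z1 - b * z2 + d))"
    for a b d x1 x2 y1 y2 z1 z2 :: real
    by (simp_all add: algebra_simps)
  have 2: "left_rhs ?u = left_rhs u + c * (left_rhs v - left_rhs v')"
    unfolding left_rhs_def by (rule ring2)
  have 3: "right_rhs ?u = right_rhs u + c * (right_rhs v - right_rhs v')"
    unfolding right_rhs_def by (rule ring2)
  have ring3: "K * (a * (x1 + c * (y1 - z1)) - b * (x2 + c * (y2 - z2)) + d * (x3 + c * (y3 - z3)))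
      = K * (a * x1 - b * x2 + d * x3)
        + c * (K * (a * y1 - b * y2 + d * y3) - K * (a * z1 - b * z2 + d * z3))"
    for K a b d x1 x2 x3 y1 y2 y3 z1 z2 z3 :: real
    by (simp add: algebra_simps)
  have 4: "GI_rhs_ge1 ?u i = GI_rhs_ge1 u i + c * (GI_rhs_ge1 v i - GI_rhs_ge1 v' i)" for i
    unfolding GI_rhs_ge1_def by (rule ring3)
  have 5: "GI_rhs_less1 ?u i = GI_rhs_less1 u i + c * (GI_rhs_less1 v i - GI_rhs_less1 v' i)" for i
    unfolding GI_rhs_less1_def by (rule ring3)
  have 6: "GII_rhs_left ?u i = GII_rhs_left u i + c * (GII_rhs_left v i - GII_rhs_left v' i)" for i
    unfolding GII_rhs_left_def by (rule ring3)
  have 7: "GII_rhs_right ?u i = GII_rhs_right u i + c * (GII_rhs_right v i - GII_rhs_right v' i)" for i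
    unfolding GII_rhs_right_def by (rule ring3)
  show ?thesis
    unfolding node_rhs_def 1 2 3 4 5 6 7
    by (simp split: prod.splits interface_type.splits)
qed

lemma grid_values_affine:
  "grid_values (\<lambda>x. w x + c * w' x)
   = (\<lambda>x. grid_values w x + c * (grid_values w' x - grid_values (\<lambda>x. 0) x))"
proof
  fix x :: "nat \<times> nat"
  obtain i j where x: "x = (i, j)" by (cases x)
  show "grid_values (\<lambda>x. w x + c * w' x) x
      = grid_values w x + c * (grid_values w' x - grid_values (\<lambda>x. 0) x)"
    unfolding x grid_values_def prod.case
    by (cases "i = 1 \<and> j = 0 \<and> bL = 0"; cases "i = m \<and> j = n \<and> bR = 0";
        cases "1 < i \<and> j = 0 \<and> ty (i - 1) = GI \<and> \<theta> (i - 1) \<ge> 1";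
        cases "i < m \<and> j = n \<and> ty i = GI \<and> \<theta> i < 1";
        simp only: if_True if_False; simp add: add_divide_distrib distrib_left mult.left_commute)
qed

lemma fv_rhs_affine:
  "fv_rhs (\<lambda>x. w x + c * w' x) p = fv_rhs w p + c * (fv_rhs w' p - fv_rhs (\<lambda>x. 0) p)"
  unfolding fv_rhs_def grid_values_affine by (rule node_rhs_affine)

lemma fv_rhs_sum:
  fixes K :: nat
  shows "fv_rhs (\<lambda>x. \<Sum>q<K. c q * e q x) p
    = fv_rhs (\<lambda>x. 0) p + (\<Sum>q<K. c q * (fv_rhs (e q) p - fv_rhs (\<lambda>x. 0) p))"
  by (induction K) (simp_all add: fv_rhs_affine)

lemma set_nodes: "(i, j) \<in> set nodes \<longleftrightarrow> 1 \<le> i \<and> i \<le> m \<and> j \<le> n"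
  by (auto simp: nodes_def)

lemma set_unknowns: "p \<in> set unknowns \<longleftrightarrow> p \<in> set nodes \<and> \<not> removed p"
  by (auto simp: unknowns_def)

lemma distinct_unknowns: "distinct unknowns"
  by (simp add: unknowns_def nodes_def distinct_product)

lemma grid_values_unknown: "p \<in> set unknowns \<Longrightarrow> grid_values w p = w p"
  by (auto simp: set_unknowns removed_def grid_values_def split: prod.splits)

lemma grid_values_cong:
  assumes eq: "\<And>x. x \<in> set unknowns \<Longrightarrow> w x = w' x" and p: "p \<in> set nodes"
  shows "grid_values w p = grid_values w' p"
proof -
  obtain i j where ij: "p = (i, j)" by (cases p)
  have b: "1 \<le> i" "i \<le> m" "j \<le> n" using p ij set_nodes by auto
  let ?L = "i = 1 \<and> j = 0 \<and> bL = 0" and ?R = "i = m \<and> j = n \<and> bR = 0"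
    and ?ge = "1 < i \<and> j = 0 \<and> ty (i - 1) = GI \<and> \<theta> (i - 1) \<ge> 1"
    and ?less = "i < m \<and> j = n \<and> ty i = GI \<and> \<theta> i < 1"
  have ge: "w (i - 1, n) = w' (i - 1, n)" if ?ge
    using b n_ge_2 that
    by (intro eq, unfold set_unknowns set_nodes removed_def prod.case) auto
  have less: "w (i + 1, 0) = w' (i + 1, 0)" if ?less
    using b n_ge_2 that
    by (intro eq, unfold set_unknowns set_nodes removed_def prod.case) auto
  have other: "w (i, j) = w' (i, j)" if "\<not> ?L" "\<not> ?R" "\<not> ?ge" "\<not> ?less"
    using b that
    by (intro eq, unfold set_unknowns set_nodes removed_def prod.case) blast
  show ?thesis
    unfolding ij grid_values_def prod.case
    by (intro if_cong refl arg_cong2[where f = "(/)"] arg_cong2[where f = "(*)"] ge less other)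
qed

lemma node_rhs_cong:
  assumes eq: "\<And>i j. 1 \<le> i \<Longrightarrow> i \<le> m \<Longrightarrow> j \<le> n \<Longrightarrow> u (i, j) = u' (i, j)"
    and ij: "1 \<le> i" "i \<le> m" "j \<le> n"
  shows "node_rhs u (i, j) = node_rhs u' (i, j)"
proof -
  have "interior_rhs u i j = interior_rhs u' i j" if "0 < j" "j < n"
    using that ij by (simp add: interior_rhs_def eq)
  moreover have "left_rhs u = left_rhs u'" "right_rhs u = right_rhs u'"
    using m_pos n_ge_2 by (simp_all add: left_rhs_def right_rhs_def eq)
  moreover have "GI_rhs_ge1 u i = GI_rhs_ge1 u' i" "GII_rhs_left u i = GII_rhs_left u' i"
    "GI_rhs_less1 u i = GI_rhs_less1 u' i" "GII_rhs_right u i = GII_rhs_right u' i"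
    if "1 \<le> i" "i < m" for i
    using that n_ge_2
    by (simp_all add: GI_rhs_ge1_def GII_rhs_left_def GI_rhs_less1_def GII_rhs_right_def eq)
  ultimately show ?thesis
    using ij unfolding node_rhs_def prod.case
    by (intro if_cong refl interface_type.case_cong) simp_all
qed

lemma fv_rhs_cong:
  assumes eq: "\<And>x. x \<in> set unknowns \<Longrightarrow> w x = w' x" and p: "p \<in> set unknowns"
  shows "fv_rhs w p = fv_rhs w' p"
proof -
  obtain i j where ij: "p = (i, j)" by (cases p)
  have b: "1 \<le> i" "i \<le> m" "j \<le> n" using p unfolding ij set_unknowns set_nodes by simp_all
  show ?thesis
    unfolding fv_rhs_def ij
    by (rule node_rhs_cong[OF _ b], rule grid_values_cong) (auto simp: set_nodes intro: eq)
qed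

lemma fv_system:
  "vec N (\<lambda>p. fv_rhs w (unknowns ! p))
   = fv_matrix *\<^sub>v vec N (\<lambda>q. w (unknowns ! q)) + fv_const"
proof (rule eq_vecI)
  fix p assume "p < dim_vec (fv_matrix *\<^sub>v vec N (\<lambda>q. w (unknowns ! q)) + fv_const)"
  then have p: "p < N" by (simp add: fv_const_def)
  let ?e = "\<lambda>q r. if r = unknowns ! q then 1 else (0 :: real)"
  have w: "w x = (\<Sum>q<N. w (unknowns ! q) * ?e q x)" if x: "x \<in> set unknowns" for x
  proof -
    obtain k where k: "k < N" "x = unknowns ! k"
      using x unfolding N_def by (metis in_set_conv_nth)
    have "(\<Sum>q<N. w (unknowns ! q) * ?e q x) = (\<Sum>q<N. if q = k then w x else 0)"
      using k distinct_unknowns by (intro sum.cong) (auto simp: N_def nth_eq_iff_index_eq)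
    then show ?thesis using k by simp
  qed
  have "fv_rhs w (unknowns ! p) = fv_rhs (\<lambda>x. \<Sum>q<N. w (unknowns ! q) * ?e q x) (unknowns ! p)"
    using p w by (intro fv_rhs_cong) (auto simp: N_def)
  also have "\<dots> = fv_rhs (\<lambda>x. 0) (unknowns ! p)
      + (\<Sum>q<N. w (unknowns ! q) * (fv_rhs (?e q) (unknowns ! p) - fv_rhs (\<lambda>x. 0) (unknowns ! p)))"
    by (rule fv_rhs_sum)
  finally show "vec N (\<lambda>p. fv_rhs w (unknowns ! p)) $ p
      = (fv_matrix *\<^sub>v vec N (\<lambda>q. w (unknowns ! q)) + fv_const) $ p"
    using p by (simp add: fv_matrix_def fv_const_def scalar_prod_def lessThan_atLeast0 mult.commute)
qed (simp add: fv_const_def)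

lemma fv_matrix_carrier: "fv_matrix \<in> carrier_mat N N"
  by (simp add: fv_matrix_def)

end

end

theory Submission
  imports Defs
begin

text \<open>
  The finite volume scheme inherits the energy balance of the diffusion problem, and this makes its
  matrix self-adjoint and negative definite for a suitable inner product, although the matrix is in
  general not symmetric. Dropping the constants \<open>cL\<close> and \<open>cR\<close>, an assignment of values to the unknowns extends
  linearly to all mesh nodes, the removed nodes being filled in by the homogeneous Dirichlet and
  type \<open>GI\<close> conditions. Multiplied by the heat capacity \<open>\<gamma> i * h i / D i\<close> of its cell (half of it at
  the ends of a layer), each equation says that the rate of change is the difference of the fluxes
  through the two faces of the cell; at a type \<open>GI\<close> interface this holds for the union of the two
  half cells.

  The jump factor \<open>\<theta> i\<close> destroys the symmetry between neighbouring layers, and the weight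
  \<open>\<kappa> i = \<theta> 1 * \<dots> * \<theta> (i - 1)\<close> of layer \<open>i\<close> restores it. With these weights, summation by parts in
  each layer leaves only contributions at the ends of the layers, and these combine at each interface
  and at each boundary to minus a symmetric, nonnegative form. The result is the Green identity
  \<open>discrete_Green\<close>: the weighted product of the right-hand side for \<open>w\<close> with \<open>w'\<close> is minus the
  energy, which is a symmetric positive semidefinite bilinear form.

  If the energy of a configuration vanishes, it is constant in each layer and satisfies
  \<open>u\<^sub>i = \<theta> i * u\<^sub>i\<^sub>+\<^sub>1\<close> at every interface, so it vanishes everywhere as soon as it vanishes at one
  boundary. The latter holds because the conditions are not both of Neumann type. Thus the energy is
  positive definite (\<open>energy_nonpos_imp_zero\<close>), and the claim is the usual statement on the spectrum
  of self-adjoint negative definite maps (\<open>eigenvalue_real_negative_if_self_adjoint\<close>).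
\<close>


section \<open>Matrices that are self-adjoint for some inner product\<close>

text \<open>
  Split a complex eigenvector into its real and imaginary parts \<open>x\<close> and \<open>y\<close>. On their span, \<open>A\<close>
  acts by \<open>A x = a x - b y\<close> and \<open>A y = b x + a y\<close>, where \<open>z = a + \<i> b\<close>. Equating
  \<open>ip (A x) y\<close> with \<open>ip (A y) x\<close> gives \<open>b * (ip x x + ip y y) = 0\<close>, so \<open>b = 0\<close>, and then each
  nonzero one of \<open>x\<close>, \<open>y\<close> is a real eigenvector.
\<close>

lemma eigenvalue_real_negative_if_self_adjoint:
  fixes A :: "real mat" and ip :: "real vec \<Rightarrow> real vec \<Rightarrow> real"
  assumes A: "A \<in> carrier_mat k k"
    and ip_add: "\<And>x y w. x \<in> carrier_vec k \<Longrightarrow> y \<in> carrier_vec k \<Longrightarrow> w \<in> carrier_vec k \<Longrightarrow>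
      ip (x + y) w = ip x w + ip y w"
    and ip_smult: "\<And>c x w. x \<in> carrier_vec k \<Longrightarrow> w \<in> carrier_vec k \<Longrightarrow> ip (c \<cdot>\<^sub>v x) w = c * ip x w"
    and ip_sym: "\<And>x y. ip x y = ip y x"
    and ip_pos: "\<And>x. x \<in> carrier_vec k \<Longrightarrow> x \<noteq> 0\<^sub>v k \<Longrightarrow> ip x x > 0"
    and self_adjoint: "\<And>x y. x \<in> carrier_vec k \<Longrightarrow> y \<in> carrier_vec k \<Longrightarrow>
      ip (A *\<^sub>v x) y = ip (A *\<^sub>v y) x"
    and neg: "\<And>x. x \<in> carrier_vec k \<Longrightarrow> x \<noteq> 0\<^sub>v k \<Longrightarrow> ip (A *\<^sub>v x) x < 0"
    and z: "eigenvalue (map_mat complex_of_real A) z"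
  shows "z \<in> \<real> \<and> Re z < 0"
proof -
  from z A obtain v where v: "v \<in> carrier_vec k" "v \<noteq> 0\<^sub>v k"
    and Av: "map_mat complex_of_real A *\<^sub>v v = z \<cdot>\<^sub>v v"
    by (auto simp: eigenvalue_def eigenvector_def)
  define x where "x = map_vec Re v"
  define y where "y = map_vec Im v"
  have xy: "x \<in> carrier_vec k" "y \<in> carrier_vec k"
    using v by (simp_all add: x_def y_def)
  have nz: "x \<noteq> 0\<^sub>v k \<or> y \<noteq> 0\<^sub>v k"
  proof (rule ccontr)
    assume c: "\<not> ?thesis"
    have "v $ i = 0" if "i < k" for i
    proof -
      have "x $ i = 0" "y $ i = 0" using c that by auto
      then show ?thesis using that v by (simp add: x_def y_def complex_eq_iff)
    qed
    then have "v = 0\<^sub>v k" using v by (intro eq_vecI) auto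
    with v show False by simp
  qed
  have Av_i: "(\<Sum>j<k. complex_of_real (A $$ (i, j)) * v $ j) = z * v $ i" if "i < k" for i
  proof -
    have "(map_mat complex_of_real A *\<^sub>v v) $ i = (z \<cdot>\<^sub>v v) $ i" by (simp add: Av)
    then show ?thesis using that A v by (simp add: scalar_prod_def lessThan_atLeast0)
  qed
  have Ax: "A *\<^sub>v x = Re z \<cdot>\<^sub>v x + (- Im z) \<cdot>\<^sub>v y"
  proof (rule eq_vecI)
    fix i assume "i < dim_vec (Re z \<cdot>\<^sub>v x + (- Im z) \<cdot>\<^sub>v y)"
    then have i: "i < k" using xy by simp
    have "Re (\<Sum>j<k. complex_of_real (A $$ (i, j)) * v $ j) = Re (z * v $ i)"
      by (simp only: Av_i[OF i])
    then show "(A *\<^sub>v x) $ i = (Re z \<cdot>\<^sub>v x + (- Im z) \<cdot>\<^sub>v y) $ i"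
      using i A v by (simp add: scalar_prod_def lessThan_atLeast0 x_def y_def)
  qed (use A xy in simp)
  have Ay: "A *\<^sub>v y = Im z \<cdot>\<^sub>v x + Re z \<cdot>\<^sub>v y"
  proof (rule eq_vecI)
    fix i assume "i < dim_vec (Im z \<cdot>\<^sub>v x + Re z \<cdot>\<^sub>v y)"
    then have i: "i < k" using xy by simp
    have "Im (\<Sum>j<k. complex_of_real (A $$ (i, j)) * v $ j) = Im (z * v $ i)"
      by (simp only: Av_i[OF i])
    then show "(A *\<^sub>v y) $ i = (Im z \<cdot>\<^sub>v x + Re z \<cdot>\<^sub>v y) $ i"
      using i A v by (simp add: scalar_prod_def lessThan_atLeast0 x_def y_def)
  qed (use A xy in simp)
  have ip_comb: "ip (a \<cdot>\<^sub>v x + b \<cdot>\<^sub>v y) w = a * ip x w + b * ip y w"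
    if "w \<in> carrier_vec k" for a b w
    using xy that by (simp add: ip_add ip_smult)
  have ip_zero: "ip (0\<^sub>v k) (0\<^sub>v k) = 0"
  proof -
    have "0 \<cdot>\<^sub>v 0\<^sub>v k = (0\<^sub>v k :: real vec)" by (intro eq_vecI) auto
    then show ?thesis using ip_smult[of "0\<^sub>v k" "0\<^sub>v k" 0] by simp
  qed
  have nonneg: "ip w w \<ge> 0" if "w \<in> carrier_vec k" for w
    using ip_pos[OF that] ip_zero by (cases "w = 0\<^sub>v k") auto
  have pos: "ip x x + ip y y > 0"
    using nz ip_pos[OF xy(1)] ip_pos[OF xy(2)] nonneg[OF xy(1)] nonneg[OF xy(2)] by linarith
  have "Im z * (ip x x + ip y y) = 0"
    using self_adjoint[OF xy] xy ip_sym[of x y] by (simp add: Ax Ay ip_comb algebra_simps)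
  then have im: "Im z = 0" using pos by simp
  have "Re z * ip w w < 0" if "w = x \<or> w = y" "w \<noteq> 0\<^sub>v k" for w
    using that neg[of w] xy im by (auto simp: Ax Ay ip_comb)
  then have "Re z < 0"
    using nz nonneg xy by (metis mult_nonneg_nonneg not_le)
  with im show ?thesis by (simp add: complex_is_Real_iff)
qed


section \<open>Homogeneous grid values\<close>

context multilayer_fv
begin

text \<open>
  Subtracting the value at \<open>w = 0\<close> removes the Dirichlet data, so this is the linear part of the
  affine map \<open>grid_values\<close>. Likewise, \<open>fv_lin\<close> below is the linear part of \<open>fv_rhs\<close>, hence the action
  of \<open>fv_matrix\<close> on functions.
\<close>

definition hom_values :: "(nat \<times> nat \<Rightarrow> real) \<Rightarrow> nat \<times> nat \<Rightarrow> real" where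
  "hom_values w p = grid_values w p - grid_values (\<lambda>x. 0) p"

definition fv_lin :: "(nat \<times> nat \<Rightarrow> real) \<Rightarrow> nat \<times> nat \<Rightarrow> real" where
  "fv_lin w p = fv_rhs w p - fv_rhs (\<lambda>x. 0) p"

lemma hom_values_affine:
  "hom_values (\<lambda>x. w x + c * w' x) p = hom_values w p + c * hom_values w' p"
  by (simp add: hom_values_def grid_values_affine)

lemma hom_values_add: "hom_values (\<lambda>x. w x + w' x) = (\<lambda>p. hom_values w p + hom_values w' p)"
  using hom_values_affine[of w 1 w'] by (simp add: fun_eq_iff)

lemma hom_values_scale: "hom_values (\<lambda>x. c * w x) = (\<lambda>p. c * hom_values w p)"
  using hom_values_affine[of "\<lambda>x. 0" c w] by (simp add: fun_eq_iff hom_values_def)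

lemma hom_values_unknown: "p \<in> set unknowns \<Longrightarrow> hom_values w p = w p"
  by (simp add: hom_values_def grid_values_unknown)

lemma hom_values_cong:
  assumes "\<And>x. x \<in> set unknowns \<Longrightarrow> w x = w' x" and "p \<in> set nodes"
  shows "hom_values w p = hom_values w' p"
  using grid_values_cong[OF assms] by (simp add: hom_values_def)

lemma hom_values_left_Dirichlet: "bL = 0 \<Longrightarrow> hom_values w (1, 0) = 0"
  unfolding hom_values_def grid_values_def by simp

lemma hom_values_right_Dirichlet: "bR = 0 \<Longrightarrow> hom_values w (m, n) = 0"
  unfolding hom_values_def grid_values_def using n_ge_2 by simp

text \<open>
  Whichever of the two nodes is removed, the extension satisfies the same interface condition. Applied
  to a rate of change instead of a configuration, it says that the rate satisfies it too. This allows
  the two cases \<open>\<theta> i \<ge> 1\<close> and \<open>\<theta> i < 1\<close> to be treated alike from here on.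
\<close>

lemma hom_values_GI:
  assumes "1 \<le> i" "i < m" "ty i = GI"
  shows "hom_values w (i, n) = \<theta> i * hom_values w (i + 1, 0)"
  using assms n_ge_2 \<theta>_pos[of i] by (auto simp: hom_values_def grid_values_def)

lemma fv_lin_node_rhs:
  "fv_lin w p = node_rhs (hom_values w) p - node_rhs (\<lambda>x. 0) p"
  using node_rhs_affine[of "\<lambda>x. 0" 1 "grid_values w" "grid_values (\<lambda>x. 0)" p]
  by (simp add: fv_lin_def fv_rhs_def hom_values_def[abs_def])

lemma h_pos: "1 \<le> i \<Longrightarrow> i \<le> m \<Longrightarrow> h i > 0"
  using l_less[of i] n_ge_2 by (simp add: h_def)


section \<open>Equations of motion in flux form\<close>

text \<open>
  This is \<open>\<gamma> i * \<partial>u/\<partial>x\<close> at the cell face between the nodes \<open>j\<close> and \<open>j + 1\<close> of layer \<open>i\<close>.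
  A type \<open>GII\<close> interface carries the flux \<open>H i * (\<theta> i * u\<^sub>i\<^sub>+\<^sub>1 - u\<^sub>i)\<close> instead. In the following lemmas the
  rate of change \<open>fv_lin w\<close> is extended to the removed nodes in the same way as \<open>w\<close> itself.
\<close>

definition flux :: "(nat \<times> nat \<Rightarrow> real) \<Rightarrow> nat \<Rightarrow> nat \<Rightarrow> real" where
  "flux u i j = \<gamma> i / h i * (u (i, j + 1) - u (i, j))"

lemma flux_form_interior:
  assumes "1 \<le> i" "i \<le> m" "0 < j" "j < n"
  shows "\<gamma> i * h i / D i * hom_values (fv_lin w) (i, j)
    = flux (hom_values w) i j - flux (hom_values w) i (j - 1)"
proof -
  have "(i, j) \<in> set unknowns"
    using assms by (simp add: set_unknowns set_nodes removed_def)
  then have R: "hom_values (fv_lin w) (i, j) = interior_rhs (hom_values w) i j"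
    using assms by (simp add: hom_values_unknown fv_lin_node_rhs node_rhs_def interior_rhs_def)
  show ?thesis
    unfolding R interior_rhs_def flux_def
    using assms h_pos[of i] D_pos[of i]
    by (simp add: field_simps power2_eq_square)
qed

lemma flux_form_left:
  assumes "bL \<noteq> 0"
  shows "\<gamma> 1 * h 1 / (2 * D 1) * hom_values (fv_lin w) (1, 0)
    = flux (hom_values w) 1 0 - \<gamma> 1 * aL / bL * hom_values w (1, 0)"
proof -
  have "(1, 0) \<in> set unknowns"
    using assms m_pos n_ge_2 by (simp add: set_unknowns set_nodes removed_def)
  then have R: "hom_values (fv_lin w) (1, 0)
      = left_rhs (hom_values w) - left_rhs (\<lambda>x. 0)"
    using n_ge_2 by (simp add: hom_values_unknown fv_lin_node_rhs node_rhs_def)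
  show ?thesis
    unfolding R left_rhs_def flux_def
    using assms m_pos h_pos[of 1] D_pos[of 1]
    by (simp add: field_simps power2_eq_square)
qed

lemma flux_form_right:
  assumes "bR \<noteq> 0"
  shows "\<gamma> m * h m / (2 * D m) * hom_values (fv_lin w) (m, n)
    = - flux (hom_values w) m (n - 1) - \<gamma> m * aR / bR * hom_values w (m, n)"
proof -
  have "(m, n) \<in> set unknowns"
    using assms m_pos n_ge_2 by (simp add: set_unknowns set_nodes removed_def)
  then have R: "hom_values (fv_lin w) (m, n)
      = right_rhs (hom_values w) - right_rhs (\<lambda>x. 0)"
    using n_ge_2 by (simp add: hom_values_unknown fv_lin_node_rhs node_rhs_def)
  show ?thesis
    unfolding R right_rhs_def flux_def
    using assms m_pos n_ge_2 h_pos[of m] D_pos[of m]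
    by (simp add: field_simps power2_eq_square)
qed

lemma flux_form_GII_left:
  assumes i: "1 \<le> i" "i < m" and ty: "ty i = GII"
  shows "\<gamma> i * h i / (2 * D i) * hom_values (fv_lin w) (i, n)
    = H i * (\<theta> i * hom_values w (i + 1, 0) - hom_values w (i, n)) - flux (hom_values w) i (n - 1)"
proof -
  have "(i, n) \<in> set unknowns"
    using i ty n_ge_2 by (simp add: set_unknowns set_nodes removed_def)
  then have R: "hom_values (fv_lin w) (i, n) = GII_rhs_left (hom_values w) i"
    using i ty n_ge_2
    by (simp add: hom_values_unknown fv_lin_node_rhs node_rhs_def GII_rhs_left_def)
  show ?thesis
    unfolding R GII_rhs_left_def flux_def
    using i n_ge_2 h_pos[of i] D_pos[of i] \<gamma>_pos[of i]
    by (simp add: field_simps power2_eq_square)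
qed

lemma flux_form_GII_right:
  assumes i: "1 \<le> i" "i < m" and ty: "ty i = GII"
  shows "\<gamma> (i + 1) * h (i + 1) / (2 * D (i + 1)) * hom_values (fv_lin w) (i + 1, 0)
    = flux (hom_values w) (i + 1) 0 - H i * (\<theta> i * hom_values w (i + 1, 0) - hom_values w (i, n))"
proof -
  have "(i + 1, 0) \<in> set unknowns"
    using i ty n_ge_2 by (simp add: set_unknowns set_nodes removed_def)
  then have R: "hom_values (fv_lin w) (i + 1, 0) = GII_rhs_right (hom_values w) i"
    using i ty n_ge_2
    by (simp add: hom_values_unknown fv_lin_node_rhs node_rhs_def GII_rhs_right_def)
  show ?thesis
    unfolding R GII_rhs_right_def flux_def
    using i n_ge_2 h_pos[of "i + 1"] D_pos[of "i + 1"] \<gamma>_pos[of "i + 1"]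
    by (simp add: field_simps power2_eq_square)
qed

text \<open>
  Both scheme equations for such an interface are the balance for the two adjacent half cells
  together, in which the unknown flux through the interface cancels. Their common denominator \<open>M\<close>
  is, up to the factor \<open>2 * D i * D (i + 1)\<close>, the heat capacity of the two half cells per unit of
  \<open>u\<^sub>i\<^sub>+\<^sub>1\<close>, because \<open>u\<^sub>i = \<theta> i * u\<^sub>i\<^sub>+\<^sub>1\<close>.
\<close>

lemma flux_form_GI:
  assumes i: "1 \<le> i" "i < m" and ty: "ty i = GI"
  shows "\<gamma> i * h i / (2 * D i) * hom_values (fv_lin w) (i, n)
      + \<gamma> (i + 1) * h (i + 1) / (2 * D (i + 1)) * hom_values (fv_lin w) (i + 1, 0)
    = flux (hom_values w) (i + 1) 0 - flux (hom_values w) i (n - 1)"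
proof -
  let ?U = "hom_values w" and ?R = "hom_values (fv_lin w)"
  define g where "g = \<gamma> i / h i"
  define g' where "g' = \<gamma> (i + 1) / h (i + 1)"
  have pos: "h i > 0" "h (i + 1) > 0" "D i > 0" "D (i + 1) > 0" "\<gamma> i > 0" "\<gamma> (i + 1) > 0" "\<theta> i > 0"
    using i h_pos D_pos \<gamma>_pos \<theta>_pos by auto
  define M where "M = \<gamma> i * h i * \<theta> i * D (i + 1) + \<gamma> (i + 1) * h (i + 1) * D i"
  have M: "M > 0" unfolding M_def using pos by (intro add_pos_pos mult_pos_pos)
  have U: "?U (i, n) = \<theta> i * ?U (i + 1, 0)" and R: "?R (i, n) = \<theta> i * ?R (i + 1, 0)"
    using hom_values_GI[OF i ty] by blast+
  have key: "?R (i + 1, 0) = 2 * D i * D (i + 1) / M *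
      (flux ?U (i + 1) 0 - flux ?U i (n - 1))"
  proof (cases "\<theta> i < 1")
    case True
    have "(i + 1, 0) \<in> set unknowns"
      using i ty n_ge_2 True by (simp add: set_unknowns set_nodes removed_def)
    then have "?R (i + 1, 0) = GI_rhs_less1 ?U i"
      using i ty n_ge_2
      by (simp add: hom_values_unknown fv_lin_node_rhs node_rhs_def GI_rhs_less1_def)
    also have "\<dots> = 2 * D i * D (i + 1) / M *
        (g * ?U (i, n - 1) - (\<theta> i * g + g') * ?U (i + 1, 0) + g' * ?U (i + 1, 1))"
      by (simp add: GI_rhs_less1_def M_def g_def g'_def)
    also have "g * ?U (i, n - 1) - (\<theta> i * g + g') * ?U (i + 1, 0) + g' * ?U (i + 1, 1)
        = flux ?U (i + 1) 0 - flux ?U i (n - 1)"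
      using n_ge_2 U by (simp add: flux_def g_def g'_def algebra_simps)
    finally show ?thesis .
  next
    case False
    have "(i, n) \<in> set unknowns"
      using i ty n_ge_2 False by (simp add: set_unknowns set_nodes removed_def)
    then have "?R (i, n) = GI_rhs_ge1 ?U i"
      using i ty n_ge_2
      by (simp add: hom_values_unknown fv_lin_node_rhs node_rhs_def GI_rhs_ge1_def)
    also have "\<dots> = 2 * D i * D (i + 1) * \<theta> i / M *
        (g * ?U (i, n - 1) - (g + g' / \<theta> i) * ?U (i, n) + g' * ?U (i + 1, 1))"
      by (simp add: GI_rhs_ge1_def M_def g_def g'_def mult.commute)
    also have "(g + g' / \<theta> i) * ?U (i, n) = g * ?U (i, n) + g' * ?U (i + 1, 0)"
      using U pos by (simp add: field_simps)
    also have "g * ?U (i, n - 1) - (g * ?U (i, n) + g' * ?U (i + 1, 0)) + g' * ?U (i + 1, 1)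
        = flux ?U (i + 1) 0 - flux ?U i (n - 1)"
      using n_ge_2 by (simp add: flux_def g_def g'_def algebra_simps)
    finally have scaled: "\<theta> i * ?R (i + 1, 0) = \<theta> i * (2 * D i * D (i + 1) / M *
        (flux ?U (i + 1) 0 - flux ?U i (n - 1)))"
      by (simp add: R ac_simps)
    have "\<theta> i \<noteq> 0" using pos by simp
    from mult_left_cancel[OF this, THEN iffD1, OF scaled] show ?thesis .
  qed
  have "\<gamma> i * h i / (2 * D i) * ?R (i, n)
      + \<gamma> (i + 1) * h (i + 1) / (2 * D (i + 1)) * ?R (i + 1, 0)
    = M / (2 * D i * D (i + 1)) * ?R (i + 1, 0)"
    unfolding R M_def using pos by (simp add: field_simps)
  also have "\<dots> = flux ?U (i + 1) 0 - flux ?U i (n - 1)"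
    unfolding key using pos M by simp
  finally show ?thesis .
qed


section \<open>The discrete Green identity\<close>

text \<open>
  The weights are determined, up to a common factor, by \<open>\<kappa> (i + 1) = \<theta> i * \<kappa> i\<close>. Then, whenever \<open>v\<close> satisfies
  \<open>v\<^sub>i = \<theta> i * v\<^sub>i\<^sub>+\<^sub>1\<close>, the weighted values \<open>\<kappa> i * v\<^sub>i\<close> and \<open>\<kappa> (i + 1) * v\<^sub>i\<^sub>+\<^sub>1\<close> agree at the interface,
  and continuity of the flux makes the boundary terms from its two sides cancel.
\<close>

definition \<kappa> :: "nat \<Rightarrow> real" where
  "\<kappa> i = (\<Prod>k=1..<i. \<theta> k)"

lemma \<kappa>_pos: "i \<le> m \<Longrightarrow> \<kappa> i > 0"
  unfolding \<kappa>_def by (intro prod_pos) (auto intro: \<theta>_pos)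

lemma \<kappa>_step: "1 \<le> i \<Longrightarrow> \<kappa> (i + 1) = \<kappa> i * \<theta> i"
  by (simp add: \<kappa>_def)

definition mass :: "nat \<Rightarrow> nat \<Rightarrow> real" where
  "mass i j = \<kappa> i * (\<gamma> i * h i / (if j = 0 \<or> j = n then 2 * D i else D i))"

lemma mass_pos: "1 \<le> i \<Longrightarrow> i \<le> m \<Longrightarrow> mass i j > 0"
  unfolding mass_def using \<kappa>_pos[of i] \<gamma>_pos[of i] h_pos[of i] D_pos[of i] by simp

text \<open>
  The sum runs over all nodes, the removed ones included. Composed with \<open>hom_values\<close> it becomes an
  inner product on the unknowns, in which the unknown at a type \<open>GI\<close> interface automatically
  carries the heat capacity of both half cells.
\<close>

definition grid_ip :: "(nat \<times> nat \<Rightarrow> real) \<Rightarrow> (nat \<times> nat \<Rightarrow> real) \<Rightarrow> real" where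
  "grid_ip u v = (\<Sum>i=1..m. \<Sum>j=0..n. mass i j * u (i, j) * v (i, j))"

lemma grid_ip_sym: "grid_ip u v = grid_ip v u"
  by (simp add: grid_ip_def mult.assoc mult.commute[of "u _"])

lemma grid_ip_add: "grid_ip (\<lambda>p. u p + u' p) v = grid_ip u v + grid_ip u' v"
  by (simp add: grid_ip_def algebra_simps sum.distrib)

lemma grid_ip_scale: "grid_ip (\<lambda>p. c * u p) v = c * grid_ip u v"
  by (simp add: grid_ip_def sum_distrib_left mult.assoc mult.left_commute[of c])

lemma grid_ip_pos:
  assumes p: "p \<in> set nodes" "u p \<noteq> 0"
  shows "grid_ip u u > 0"
proof -
  obtain i j where ij: "p = (i, j)" by (cases p)
  have b: "i \<in> {1..m}" "j \<in> {0..n}" using p ij set_nodes by auto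
  have nonneg: "mass i' j' * u (i', j') * u (i', j') \<ge> 0" if "i' \<in> {1..m}" for i' j'
    using mass_pos[of i' j'] that by (simp add: mult.assoc)
  have "mass i j * u (i, j) * u (i, j) > 0"
    using p(2) b mass_pos[of i j] unfolding ij
    by (simp add: mult.assoc) (metis mult_neg_neg mult_pos_pos linorder_neqE_linordered_idom)
  then have "(\<Sum>j=0..n. mass i j * u (i, j) * u (i, j)) > 0"
    using b nonneg by (intro sum_pos2[of _ j]) auto
  then show ?thesis
    unfolding grid_ip_def
  proof (intro sum_pos2[of "{1..m}" i])
    show "(\<Sum>j'=0..n. mass i' j' * u (i', j') * u (i', j')) \<ge> 0" if "i' \<in> {1..m}" for i'
      using nonneg[OF that] by (intro sum_nonneg)
  qed (use b in auto)
qed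

definition interface_energy ::
  "(nat \<times> nat \<Rightarrow> real) \<Rightarrow> (nat \<times> nat \<Rightarrow> real) \<Rightarrow> nat \<Rightarrow> real" where
  "interface_energy u v i = (case ty i of GI \<Rightarrow> 0
     | GII \<Rightarrow> \<kappa> i * H i * ((\<theta> i * u (i + 1, 0) - u (i, n)) * (\<theta> i * v (i + 1, 0) - v (i, n))))"

definition layer_energy ::
  "(nat \<times> nat \<Rightarrow> real) \<Rightarrow> (nat \<times> nat \<Rightarrow> real) \<Rightarrow> nat \<Rightarrow> real" where
  "layer_energy u v i =
     (\<Sum>j<n. \<kappa> i * \<gamma> i / h i * ((u (i, j + 1) - u (i, j)) * (v (i, j + 1) - v (i, j))))"

text \<open>
  Because \<open>x / 0 = 0\<close>, the terms for the outer boundaries vanish under Dirichlet conditions, as they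
  should: there \<open>u\<close> and \<open>v\<close> vanish.
\<close>

definition energy :: "(nat \<times> nat \<Rightarrow> real) \<Rightarrow> (nat \<times> nat \<Rightarrow> real) \<Rightarrow> real" where
  "energy u v = (\<Sum>i=1..m. layer_energy u v i) + (\<Sum>i=1..<m. interface_energy u v i)
     + \<kappa> 1 * \<gamma> 1 * aL / bL * (u (1, 0) * v (1, 0))
     + \<kappa> m * \<gamma> m * aR / bR * (u (m, n) * v (m, n))"

lemma energy_sym: "energy u v = energy v u"
proof -
  have "layer_energy u v i = layer_energy v u i" for i
    unfolding layer_energy_def
    by (intro sum.cong refl arg_cong2[where f = "(*)"] mult.commute)
  moreover have "interface_energy u v i = interface_energy v u i" for i
    by (simp add: interface_energy_def split: interface_type.split)
  ultimately show ?thesis by (simp add: energy_def mult.commute)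
qed

lemma summation_by_parts:
  fixes F v :: "nat \<Rightarrow> real"
  assumes "k \<ge> 1"
  shows "(\<Sum>j=1..<k. (F j - F (j - 1)) * v j)
    = F (k - 1) * v k - F 0 * v 0 - (\<Sum>j<k. F j * (v (j + 1) - v j))"
  using assms by (induction k rule: dec_induct) (simp_all add: algebra_simps)

text \<open>
  The contribution of the node \<open>(i, 0)\<close> to the weighted product that summation by parts in layer \<open>i\<close>
  leaves over: the rate of change of its half cell minus the flux through the inner face of that
  cell, tested with \<open>v\<close>. The counterpart at \<open>(i, n)\<close> is \<open>right_end\<close>; there the inner face is
  the left one, whence the opposite sign.
\<close>

definition left_end :: "(nat \<times> nat \<Rightarrow> real) \<Rightarrow> (nat \<times> nat \<Rightarrow> real) \<Rightarrow> nat \<Rightarrow> real" where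
  "left_end w v i = \<kappa> i * (\<gamma> i * h i / (2 * D i) * hom_values (fv_lin w) (i, 0)
     - flux (hom_values w) i 0) * v (i, 0)"

definition right_end :: "(nat \<times> nat \<Rightarrow> real) \<Rightarrow> (nat \<times> nat \<Rightarrow> real) \<Rightarrow> nat \<Rightarrow> real" where
  "right_end w v i = \<kappa> i * (\<gamma> i * h i / (2 * D i) * hom_values (fv_lin w) (i, n)
     + flux (hom_values w) i (n - 1)) * v (i, n)"

lemma layer_Green:
  assumes i: "1 \<le> i" "i \<le> m"
  shows "(\<Sum>j=0..n. mass i j * hom_values (fv_lin w) (i, j) * v (i, j))
    = left_end w v i + right_end w v i - layer_energy (hom_values w) v i"
proof -
  let ?R = "hom_values (fv_lin w)" and ?F = "flux (hom_values w) i"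
  have energy: "\<kappa> i * (\<Sum>j<n. ?F j * (v (i, j + 1) - v (i, j))) = layer_energy (hom_values w) v i"
    unfolding layer_energy_def sum_distrib_left by (intro sum.cong) (simp_all add: flux_def)
  have "{0..n} = insert 0 (insert n {1..<n})" using n_ge_2 by auto
  then have "(\<Sum>j=0..n. mass i j * ?R (i, j) * v (i, j))
      = mass i 0 * ?R (i, 0) * v (i, 0) + mass i n * ?R (i, n) * v (i, n)
        + (\<Sum>j=1..<n. mass i j * ?R (i, j) * v (i, j))"
    using n_ge_2 by simp
  also have "(\<Sum>j=1..<n. mass i j * ?R (i, j) * v (i, j))
      = (\<Sum>j=1..<n. \<kappa> i * ((?F j - ?F (j - 1)) * v (i, j)))"
  proof (rule sum.cong)
    fix j assume "j \<in> {1..<n}"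
    then show "mass i j * ?R (i, j) * v (i, j) = \<kappa> i * ((?F j - ?F (j - 1)) * v (i, j))"
      using flux_form_interior[OF i, of j w, symmetric] by (simp add: mass_def)
  qed simp
  also have "\<dots> = \<kappa> i * (\<Sum>j=1..<n. (?F j - ?F (j - 1)) * v (i, j))"
    by (simp add: sum_distrib_left)
  also have "(\<Sum>j=1..<n. (?F j - ?F (j - 1)) * v (i, j))
      = ?F (n - 1) * v (i, n) - ?F 0 * v (i, 0) - (\<Sum>j<n. ?F j * (v (i, j + 1) - v (i, j)))"
    using n_ge_2 by (intro summation_by_parts) simp
  also have "\<kappa> i * (?F (n - 1) * v (i, n) - ?F 0 * v (i, 0)
        - (\<Sum>j<n. ?F j * (v (i, j + 1) - v (i, j))))
      = \<kappa> i * (?F (n - 1) * v (i, n) - ?F 0 * v (i, 0)) - layer_energy (hom_values w) v i"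
    unfolding right_diff_distrib[of "\<kappa> i"] energy by simp
  finally show ?thesis
    by (simp add: left_end_def right_end_def mass_def algebra_simps)
qed

text \<open>
  At a type \<open>GI\<close> interface neither end is known by itself, since the flux through the interface is
  eliminated from the scheme. The test values on its two sides satisfy \<open>\<kappa> i * v\<^sub>i = \<kappa> (i + 1) * v\<^sub>i\<^sub>+\<^sub>1\<close>,
  so only the sum of the two rates enters, and that is the difference of the inner fluxes. At a type
  \<open>GII\<close> interface the two ends equal the interface flux times \<open>\<kappa> i * v\<^sub>i\<close> and minus the interface
  flux times \<open>\<kappa> i * \<theta> i * v\<^sub>i\<^sub>+\<^sub>1\<close>; their sum is symmetric because that flux is \<open>H i\<close> times the same
  combination \<open>\<theta> i * u\<^sub>i\<^sub>+\<^sub>1 - u\<^sub>i\<close>.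
\<close>

lemma ends_at_interface:
  assumes i: "1 \<le> i" "i < m"
  shows "right_end w (hom_values w') i + left_end w (hom_values w') (i + 1)
    = - interface_energy (hom_values w) (hom_values w') i"
proof (cases "ty i")
  case GI
  let ?r = "\<gamma> i * h i / (2 * D i) * hom_values (fv_lin w) (i, n)"
  let ?s = "\<gamma> (i + 1) * h (i + 1) / (2 * D (i + 1)) * hom_values (fv_lin w) (i + 1, 0)"
  have "right_end w (hom_values w') i + left_end w (hom_values w') (i + 1)
      = \<kappa> i * \<theta> i * hom_values w' (i + 1, 0) *
        (?r + ?s - (flux (hom_values w) (i + 1) 0 - flux (hom_values w) i (n - 1)))"
    unfolding left_end_def right_end_def hom_values_GI[OF i GI, of w'] \<kappa>_step[OF i(1)]
    by (simp only: algebra_simps)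
  also have "\<dots> = 0" unfolding flux_form_GI[OF i GI] by simp
  finally show ?thesis using GI by (simp add: interface_energy_def)
next
  case GII
  show ?thesis
    unfolding left_end_def right_end_def \<kappa>_step[OF i(1)]
      flux_form_GII_left[OF i GII] flux_form_GII_right[OF i GII]
    using GII by (simp add: interface_energy_def algebra_simps)
qed

lemma left_end_boundary:
  "left_end w (hom_values w') 1
    = - (\<kappa> 1 * \<gamma> 1 * aL / bL * (hom_values w (1, 0) * hom_values w' (1, 0)))"
proof (cases "bL = 0")
  case True
  show ?thesis unfolding left_end_def hom_values_left_Dirichlet[OF True] by simp
next
  case False
  show ?thesis unfolding left_end_def flux_form_left[OF False] by simp
qed

lemma right_end_boundary:
  "right_end w (hom_values w') m
    = - (\<kappa> m * \<gamma> m * aR / bR * (hom_values w (m, n) * hom_values w' (m, n)))"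
proof (cases "bR = 0")
  case True
  show ?thesis unfolding right_end_def hom_values_right_Dirichlet[OF True] by simp
next
  case False
  show ?thesis unfolding right_end_def flux_form_right[OF False] by simp
qed

lemma sum_ends_regroup:
  fixes f g :: "nat \<Rightarrow> real"
  assumes "1 \<le> k"
  shows "(\<Sum>i=1..k. f i + g i) = f 1 + g k + (\<Sum>i=1..<k. g i + f (i + 1))"
  using assms by (induction k rule: dec_induct) simp_all

text \<open>
  The discrete counterpart of \<open>\<integral> (\<gamma> u')' v = - \<integral> \<gamma> u' v'\<close> plus boundary terms, weighted by \<open>\<kappa>\<close> and
  summed over the layers. That both arguments enter through \<open>hom_values\<close> matters: \<open>w'\<close> must satisfy
  the homogeneous conditions for the boundary terms to combine, and the rate must satisfy them at
  type \<open>GI\<close> interfaces.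
\<close>

theorem discrete_Green:
  "grid_ip (hom_values (fv_lin w)) (hom_values w') = - energy (hom_values w) (hom_values w')"
proof -
  let ?V = "hom_values w'"
  have "grid_ip (hom_values (fv_lin w)) ?V
      = (\<Sum>i=1..m. (left_end w ?V i + right_end w ?V i) - layer_energy (hom_values w) ?V i)"
    unfolding grid_ip_def by (intro sum.cong) (auto simp: layer_Green)
  also have "\<dots> = left_end w ?V 1 + right_end w ?V m
      + (\<Sum>i=1..<m. right_end w ?V i + left_end w ?V (i + 1))
      - (\<Sum>i=1..m. layer_energy (hom_values w) ?V i)"
    unfolding sum_subtractf sum_ends_regroup[OF m_pos] ..
  also have "(\<Sum>i=1..<m. right_end w ?V i + left_end w ?V (i + 1))
      = - (\<Sum>i=1..<m. interface_energy (hom_values w) ?V i)"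
    unfolding sum_negf[symmetric] by (intro sum.cong ends_at_interface) auto
  finally show ?thesis
    unfolding left_end_boundary right_end_boundary energy_def by simp
qed


section \<open>Positivity of the energy\<close>

lemma energy_terms_nonneg:
  shows "1 \<le> i \<Longrightarrow> i \<le> m \<Longrightarrow> layer_energy u u i \<ge> 0"
    and "1 \<le> i \<Longrightarrow> i < m \<Longrightarrow> interface_energy u u i \<ge> 0"
    and "\<kappa> 1 * \<gamma> 1 * aL / bL * (u (1, 0) * u (1, 0)) \<ge> 0"
    and "\<kappa> m * \<gamma> m * aR / bR * (u (m, n) * u (m, n)) \<ge> 0"
proof -
  show "layer_energy u u i \<ge> 0" if "1 \<le> i" "i \<le> m"
    unfolding layer_energy_def using that \<kappa>_pos[of i] \<gamma>_pos[of i] h_pos[of i]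
    by (intro sum_nonneg) simp
  show "interface_energy u u i \<ge> 0" if "1 \<le> i" "i < m"
  proof (cases "ty i")
    case GII
    then have "\<kappa> i * H i > 0" using that \<kappa>_pos[of i] H_pos[of i] by simp
    then show ?thesis
      unfolding interface_energy_def GII interface_type.case
      by (intro mult_nonneg_nonneg zero_le_square less_imp_le)
  qed (simp add: interface_energy_def)
  show "\<kappa> 1 * \<gamma> 1 * aL / bL * (u (1, 0) * u (1, 0)) \<ge> 0"
    using m_pos \<kappa>_pos[of 1] \<gamma>_pos[of 1] boundary_nonneg by simp
  show "\<kappa> m * \<gamma> m * aR / bR * (u (m, n) * u (m, n)) \<ge> 0"
    using m_pos \<kappa>_pos[of m] \<gamma>_pos[of m] boundary_nonneg by simp
qed

text \<open>
  Every term of the energy is nonnegative, so each of them vanishes. The layer terms make the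
  configuration constant in each layer, the interface terms (or the type \<open>GI\<close> condition) link
  the constants of neighbouring layers by the nonzero factor \<open>\<theta> i\<close>, and a boundary condition with
  \<open>aL > 0\<close> or \<open>aR > 0\<close> makes one of the constants zero.
\<close>

lemma energy_nonpos_imp_zero:
  assumes E: "energy (hom_values w) (hom_values w) \<le> 0" and p: "p \<in> set nodes"
  shows "hom_values w p = 0"
proof -
  let ?U = "hom_values w"
  have sums: "(\<Sum>i=1..m. layer_energy ?U ?U i) \<ge> 0" "(\<Sum>i=1..<m. interface_energy ?U ?U i) \<ge> 0"
    by (auto intro!: sum_nonneg energy_terms_nonneg)
  note nonneg = sums energy_terms_nonneg(3,4)[of ?U]
  have layers: "(\<Sum>i=1..m. layer_energy ?U ?U i) = 0"
    and interfaces: "(\<Sum>i=1..<m. interface_energy ?U ?U i) = 0"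
    and left: "\<kappa> 1 * \<gamma> 1 * aL / bL * (?U (1, 0) * ?U (1, 0)) = 0"
    and right: "\<kappa> m * \<gamma> m * aR / bR * (?U (m, n) * ?U (m, n)) = 0"
    using E nonneg unfolding energy_def by linarith+
  have step: "?U (i, j + 1) = ?U (i, j)" if i: "1 \<le> i" "i \<le> m" and j: "j < n" for i j
  proof -
    have pos: "\<kappa> i * \<gamma> i / h i > 0" using i \<kappa>_pos[of i] \<gamma>_pos[of i] h_pos[of i] by simp
    have "layer_energy ?U ?U i = 0"
      using layers i by (subst (asm) sum_nonneg_eq_0_iff) (auto intro: energy_terms_nonneg)
    then have "\<kappa> i * \<gamma> i / h i * ((?U (i, j + 1) - ?U (i, j)) * (?U (i, j + 1) - ?U (i, j))) = 0"
      unfolding layer_energy_def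
      by (subst (asm) sum_nonneg_eq_0_iff)
        (use j in \<open>simp_all only: lessThan_iff finite_lessThan
            mult_nonneg_nonneg zero_le_square less_imp_le[OF pos]\<close>)
    moreover have "\<kappa> i * \<gamma> i / h i \<noteq> 0" using pos by (rule less_imp_neq[THEN not_sym])
    ultimately have "(?U (i, j + 1) - ?U (i, j)) * (?U (i, j + 1) - ?U (i, j)) = 0"
      by (simp only: mult_eq_0_iff simp_thms)
    then show ?thesis by simp
  qed
  have const: "?U (i, j) = ?U (i, 0)" if "1 \<le> i" "i \<le> m" "j \<le> n" for i j
    using that(3) by (induction j) (use that step in auto)
  have jump: "?U (i, n) = \<theta> i * ?U (i + 1, 0)" if i: "1 \<le> i" "i < m" for i
  proof (cases "ty i")
    case GI
    then show ?thesis using hom_values_GI[OF i] by simp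
  next
    case GII
    have "interface_energy ?U ?U i = 0"
      using interfaces i by (subst (asm) sum_nonneg_eq_0_iff) (auto intro: energy_terms_nonneg)
    then show ?thesis
      using GII i \<kappa>_pos[of i] H_pos[of i] by (simp add: interface_energy_def)
  qed
  have transfer: "?U (i, 0) = 0 \<longleftrightarrow> ?U (i + 1, 0) = 0" if "1 \<le> i" "i < m" for i
    using jump[OF that] const[of i n] \<theta>_pos[OF that] that by simp
  have all_layers: "?U (i, 0) = 0 \<longleftrightarrow> ?U (1, 0) = 0" if "1 \<le> i" "i \<le> m" for i
    using that by (induction i rule: dec_induct) (use transfer in auto)
  have "?U (1, 0) = 0"
  proof (cases "aL = 0")
    case False
    show ?thesis
    proof (cases "bL = 0")
      case True
      then show ?thesis by (rule hom_values_left_Dirichlet)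
    next
      case False
      then show ?thesis
        using left \<open>aL \<noteq> 0\<close> m_pos \<kappa>_pos[of 1] \<gamma>_pos[of 1] by simp
    qed
  next
    case True
    then have aR: "aR \<noteq> 0" using not_both_Neumann by simp
    have "?U (m, n) = 0"
    proof (cases "bR = 0")
      case True
      then show ?thesis by (rule hom_values_right_Dirichlet)
    next
      case False
      then show ?thesis
        using right aR m_pos \<kappa>_pos[of m] \<gamma>_pos[of m] by simp
    qed
    then show ?thesis using const[of m n] all_layers[of m] m_pos by simp
  qed
  moreover obtain i j where ij: "p = (i, j)" by (cases p)
  moreover have "1 \<le> i" "i \<le> m" "j \<le> n"
    using p set_nodes[of i j] unfolding ij by auto
  ultimately show ?thesis using const all_layers by metis
qed


section \<open>The coefficient matrix\<close>

text \<open>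
  This form, unlike a search for the index of \<open>p\<close>, is evidently linear in \<open>x\<close>.
\<close>

definition unknown_values :: "real vec \<Rightarrow> nat \<times> nat \<Rightarrow> real" where
  "unknown_values x p = (\<Sum>q<N. if unknowns ! q = p then x $ q else 0)"

lemma unknown_values_nth:
  assumes "k < N"
  shows "unknown_values x (unknowns ! k) = x $ k"
proof -
  have "unknown_values x (unknowns ! k) = (\<Sum>q<N. if q = k then x $ q else 0)"
    unfolding unknown_values_def using assms distinct_unknowns
    by (intro sum.cong) (auto simp: N_def nth_eq_iff_index_eq)
  then show ?thesis using assms by simp
qed

lemma fv_matrix_mult:
  assumes "x \<in> carrier_vec N" and "k < N"
  shows "(fv_matrix *\<^sub>v x) $ k = fv_lin (unknown_values x) (unknowns ! k)"
proof -
  have "vec N (\<lambda>q. unknown_values x (unknowns ! q)) = x"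
    using assms(1) by (intro eq_vecI) (auto simp: unknown_values_nth)
  then have "vec N (\<lambda>p. fv_rhs (unknown_values x) (unknowns ! p)) = fv_matrix *\<^sub>v x + fv_const"
    using fv_system[of "unknown_values x"] by simp
  from arg_cong[OF this, of "\<lambda>y. y $ k"] show ?thesis
    using assms(2) fv_matrix_carrier by (simp add: fv_const_def fv_lin_def)
qed

definition vec_ip :: "real vec \<Rightarrow> real vec \<Rightarrow> real" where
  "vec_ip x y = grid_ip (hom_values (unknown_values x)) (hom_values (unknown_values y))"

lemma vec_ip_fv_matrix:
  assumes "x \<in> carrier_vec N"
  shows "vec_ip (fv_matrix *\<^sub>v x) y
    = - energy (hom_values (unknown_values x)) (hom_values (unknown_values y))"
proof -
  have eq: "unknown_values (fv_matrix *\<^sub>v x) p = fv_lin (unknown_values x) p"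
    if "p \<in> set unknowns" for p
    using that fv_matrix_mult[OF assms]
    by (metis N_def in_set_conv_nth unknown_values_nth)
  have "vec_ip (fv_matrix *\<^sub>v x) y
      = grid_ip (hom_values (fv_lin (unknown_values x))) (hom_values (unknown_values y))"
    unfolding vec_ip_def grid_ip_def
    by (intro sum.cong refl arg_cong2[where f = "(*)"] hom_values_cong eq) (auto simp: set_nodes)
  then show ?thesis by (simp add: discrete_Green)
qed

lemma hom_values_nonzero:
  assumes "x \<in> carrier_vec N" and "x \<noteq> 0\<^sub>v N"
  obtains p where "p \<in> set nodes" "hom_values (unknown_values x) p \<noteq> 0"
proof -
  obtain k where k: "k < N" "x $ k \<noteq> 0"
    using assms by (metis carrier_vecD eq_vecI index_zero_vec)
  then have "unknowns ! k \<in> set unknowns" by (simp add: N_def)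
  with k that[of "unknowns ! k"] show thesis
    by (simp add: set_unknowns hom_values_unknown unknown_values_nth)
qed

theorem fv_matrix_eigenvalue:
  assumes "eigenvalue (map_mat complex_of_real fv_matrix) z"
  shows "z \<in> \<real> \<and> Re z < 0"
proof (rule eigenvalue_real_negative_if_self_adjoint[OF fv_matrix_carrier, where ip = vec_ip])
  fix x y w :: "real vec" and c :: real
  assume x: "x \<in> carrier_vec N"
  show "vec_ip (x + y) w = vec_ip x w + vec_ip y w" if y: "y \<in> carrier_vec N"
  proof -
    have "unknown_values (x + y) = (\<lambda>p. unknown_values x p + unknown_values y p)"
      using x y by (auto simp: fun_eq_iff unknown_values_def sum.distrib[symmetric] intro!: sum.cong)
    then show ?thesis by (simp add: vec_ip_def hom_values_add grid_ip_add)
  qed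
  have "unknown_values (c \<cdot>\<^sub>v x) = (\<lambda>p. c * unknown_values x p)"
    using x by (auto simp: fun_eq_iff unknown_values_def sum_distrib_left intro!: sum.cong)
  then show "vec_ip (c \<cdot>\<^sub>v x) w = c * vec_ip x w"
    by (simp add: vec_ip_def hom_values_scale grid_ip_scale)
  show "vec_ip (fv_matrix *\<^sub>v x) y = vec_ip (fv_matrix *\<^sub>v y) x" if "y \<in> carrier_vec N"
    using x that by (simp add: vec_ip_fv_matrix energy_sym)
  assume nz: "x \<noteq> 0\<^sub>v N"
  obtain p where p: "p \<in> set nodes" "hom_values (unknown_values x) p \<noteq> 0"
    using hom_values_nonzero[OF x nz] .
  show "vec_ip x x > 0" unfolding vec_ip_def using p by (rule grid_ip_pos)
  show "vec_ip (fv_matrix *\<^sub>v x) x < 0"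
    using energy_nonpos_imp_zero[OF _ p(1)] p(2) unfolding vec_ip_fv_matrix[OF x] by force
next
  show "vec_ip x y = vec_ip y x" for x y unfolding vec_ip_def by (rule grid_ip_sym)
qed (rule assms)

end

theorem theorem3p1:
  fixes m n :: nat
    and l D \<gamma> \<theta> H :: "nat \<Rightarrow> real"
    and ty :: "nat \<Rightarrow> interface_type"
    and aL bL cL aR bR cR :: real
    and A :: "real mat"
  assumes "multilayer_fv m n l D \<gamma> \<theta> H ty aL bL cL aR bR cR"
    and "A = multilayer_fv.fv_matrix m n l D \<gamma> \<theta> H ty aL bL cL aR bR cR"
  shows "\<forall>z. eigenvalue (map_mat complex_of_real A) z \<longrightarrow> z \<in> \<real> \<and> Re z < 0"
  using multilayer_fv.fv_matrix_eigenvalue[OF assms(1)] unfolding assms(2) by blast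

end
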